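(* Let $(X_i)_{i\in\mathbb{N}}$ be an $\alpha$-mixing sequence of identically distributed real random variables on a probability space $(\Omega,\mathcal{F},\mathbb{P})$ with distribution function $F$, and let $\widehat F_n=\frac1n\sum_{i=1}^n\mathbf{1}_{[X_i,\infty)}$. Let $r\in[0,\frac12)$, and assume that the mixing coefficients satisfy $\alpha(n)\le Kn^{-\vartheta}$ for all $n\in\mathbb{N}$ and some constants $K>0$, $\vartheta>2r$. Let $y\in(0,1)$, and assume that $F$ is differentiable at $F^{\leftarrow}(y)$ with $F'(F^{\leftarrow}(y))>0$. Then $$n^r\,|\widehat F_n^{\leftarrow}(y)-F^{\leftarrow}(y)|\longrightarrow0\qquad\mathbb{P}\text{-a.s. as } n\to\infty.$$
   Context: The mixing coefficients are $\alpha(n):=\sup_{k\ge1}\sup_{A,B}|\mathbb{P}[A\cap B]-\mathbb{P}[A]\mathbb{P}[B]|$, where the second supremum ranges over all $A\in\sigma(X_1,\dots,X_k)$ and $B\in\sigma(X_{k+n},X_{k+n+1},\dots)$. The sequence is $\alpha$-mixing if $\alpha(n)\to0$ as $n\to\infty$. For a nondecreasing function $H:\mathbb{R}\to\mathbb{R}$, $H^{\leftarrow}(x):=\inf\{y\in\mathbb{R}:H(y)\ge x\}$, $x\in\mathbb{R}$, denotes its left-continuous inverse, with $\inf\emptyset:=\infty$. *)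

theory Defs
  imports "HOL-Probability.Probability"
begin

definition sigma_rvs :: "'a measure \<Rightarrow> (nat \<Rightarrow> 'a \<Rightarrow> real) \<Rightarrow> nat set \<Rightarrow> 'a set set" where
  "sigma_rvs M X I =
     sigma_sets (space M) {X i -` S \<inter> space M | i S. i \<in> I \<and> S \<in> sets borel}"

text \<open>On a probability space both suprema range over nonempty subsets of \<open>{0..1}\<close>, so the
  conditionally complete supremum of the reals is the true one. Sequences are indexed from 1;
  the value \<open>X 0\<close> is never used.\<close>

definition alpha_coeff :: "'a measure \<Rightarrow> (nat \<Rightarrow> 'a \<Rightarrow> real) \<Rightarrow> nat \<Rightarrow> real" where
  "alpha_coeff M X n =
     (SUP k\<in>{1..}. SUP (A, B)\<in>sigma_rvs M X {1..k} \<times> sigma_rvs M X {k + n..}.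
        \<bar>measure M (A \<inter> B) - measure M A * measure M B\<bar>)"

definition alpha_mixing :: "'a measure \<Rightarrow> (nat \<Rightarrow> 'a \<Rightarrow> real) \<Rightarrow> bool" where
  "alpha_mixing M X \<longleftrightarrow> alpha_coeff M X \<longlonglongrightarrow> 0"

text \<open>Extended-real valued, since the infimum is \<open>\<infinity>\<close> over the empty set and may be \<open>-\<infinity>\<close>.\<close>

definition left_inv :: "(real \<Rightarrow> real) \<Rightarrow> real \<Rightarrow> ereal" where
  "left_inv H x = Inf (ereal ` {y. H y \<ge> x})"

definition emp_cdf :: "(nat \<Rightarrow> 'a \<Rightarrow> real) \<Rightarrow> nat \<Rightarrow> 'a \<Rightarrow> real \<Rightarrow> real" where
  "emp_cdf X n \<omega> x = 1 / real n * (\<Sum>i=1..n. indicator {X i \<omega>..} x)"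

end

theory Submission
  imports Defs "HOL-Real_Asymp.Real_Asymp"
begin

text \<open>
  Write \<open>q\<close> for the \<open>y\<close>-quantile of \<open>F\<close>. As \<open>F\<close> is continuous at \<open>q\<close>, \<open>F q = y\<close>, and the positive
  derivative gives \<open>F (q + h) \<ge> y + c * h\<close> and \<open>F (q - h) \<le> y - c * h\<close> for small \<open>h > 0\<close>. Hence the
  empirical quantile lies within \<open>h\<close> of \<open>q\<close> as soon as the empirical distribution function is
  strictly within \<open>c * h\<close> of \<open>F\<close> at the two points \<open>q \<plusminus> h\<close>. For the rate \<open>r\<close>, this must hold for
  \<open>h = \<epsilon> * n powr (- r)\<close> with every small \<open>\<epsilon> > 0\<close>, so the two points move with \<open>n\<close>. They can be
  frozen on dyadic blocks: locating the quantile within a smaller \<open>h\<close> is a stronger assertion, so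
  the single width \<open>h = \<epsilon> * 2 powr (- r * J)\<close> serves the whole block
  \<open>2 ^ (J - 1) \<le> n \<le> 2 ^ J\<close>. It remains to control, for two fixed indicator functions per block,
  the partial sums of the centred indicators uniformly over the block.

  This is done by a maximal inequality of Rademacher-Menshov type (\<open>maximal_inequality\<close>). Any partial sum
  up to \<open>2 ^ J\<close> is a sum of at most one dyadic increment per level, so its square is at most
  \<open>J + 1\<close> times the sum of the squares of all dyadic increments, a random variable that does not
  depend on the index of the partial sum (\<open>square_le_dyadic_increments\<close>). Mixing bounds the
  covariances of the indicators by \<open>alpha_coeff\<close>. Choosing \<open>2 * r < s < min 1 \<theta>\<close>, an
  increment of length \<open>L\<close> has second moment of order \<open>L powr (2 - s)\<close>, and Markov's inequality
  bounds the probability of a deviation of the order \<open>2 powr ((1 - r) * J)\<close> by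
  \<open>(J + 1)\<^sup>2 * 2 powr (- (s - 2 * r) * J)\<close> up to a constant. This is summable over \<open>J\<close>, and the
  Borel-Cantelli lemma finishes the argument (\<open>emp_cdf_deviation_at_moving_thresholds\<close>).
\<close>

section \<open>A maximal inequality for weakly correlated random variables\<close>

text \<open>Truncating the binary expansion of \<open>m\<close> at the successive levels \<open>l\<close> gives a chain from \<open>m\<close>
  down to \<open>0\<close>. Each link of the chain is empty or a dyadic interval of length \<open>2 ^ l\<close>, so
  \<open>S m\<close> is a sum of at most \<open>J + 1\<close> dyadic increments and the Cauchy-Schwarz inequality applies.
  The right-hand side is the same for all \<open>m \<le> 2 ^ J\<close>.\<close>

lemma square_le_dyadic_increments:
  fixes S :: "nat \<Rightarrow> real"
  assumes "S 0 = 0" and m: "m \<le> 2 ^ J"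
  shows "(S m)\<^sup>2 \<le> (real J + 1) *
    (\<Sum>l\<le>J. \<Sum>b<2 ^ (J - l). (S (Suc b * 2 ^ l) - S (b * 2 ^ l))\<^sup>2)"
proof -
  \<comment> \<open>\<open>T l\<close> is \<open>S\<close> at \<open>m\<close> with its last \<open>l\<close> binary digits replaced by \<open>0\<close>.\<close>
  define T where "T l = S (2 ^ l * (m div 2 ^ l))" for l
  have "m < 2 ^ Suc J"
    using m by (simp add: le_less_trans)
  then have ends: "T 0 = S m" "T (Suc J) = 0"
    using \<open>S 0 = 0\<close> by (simp_all add: T_def)
  have "S m = (\<Sum>l\<le>J. T l - T (Suc l))"
    by (simp only: sum_telescope ends diff_zero)
  then have "(S m)\<^sup>2 \<le> (\<Sum>l\<le>J. (T l - T (Suc l))\<^sup>2) * (real J + 1)"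
    using sum_squared_le_sum_of_squares[of "\<lambda>l. T l - T (Suc l)" "{..J}"] by (simp add: add.commute)
  also have "\<dots> \<le> (\<Sum>l\<le>J. \<Sum>b<2 ^ (J - l). (S (Suc b * 2 ^ l) - S (b * 2 ^ l))\<^sup>2) * (real J + 1)"
  proof (intro mult_right_mono sum_mono)
    fix l assume "l \<in> {..J}"
    then have l: "l \<le> J" by simp
    define k where "k = m div 2 ^ Suc l"
    have k: "k = m div 2 ^ l div 2"
      unfolding k_def power_Suc2 by (rule div_mult2_eq)
    have T_Suc: "T (Suc l) = S (2 * k * 2 ^ l)"
      by (simp add: T_def k_def mult_ac)
    show "(T l - T (Suc l))\<^sup>2 \<le> (\<Sum>b<2 ^ (J - l). (S (Suc b * 2 ^ l) - S (b * 2 ^ l))\<^sup>2)"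
    proof (cases "even (m div 2 ^ l)")
      case True
      then have "m div 2 ^ l = 2 * k" using k by simp
      then have "T l = S (2 * k * 2 ^ l)" by (simp add: T_def mult.commute)
      with T_Suc show ?thesis by (simp add: sum_nonneg)
    next
      case False
      then have odd: "m div 2 ^ l = Suc (2 * k)" using k by (simp add: odd_two_times_div_two_succ)
      have "m div 2 ^ l \<le> 2 ^ J div 2 ^ l" by (rule div_le_mono[OF m])
      also have "\<dots> = 2 ^ (J - l)" using l by (simp add: power_diff)
      finally have "2 * k \<in> {..<2 ^ (J - l)}" using odd by simp
      moreover have "T l = S (Suc (2 * k) * 2 ^ l)" by (simp add: T_def odd mult_ac)
      ultimately show ?thesis
        using member_le_sum[of "2 * k" "{..<2 ^ (J - l)}" "\<lambda>b. (S (Suc b * 2 ^ l) - S (b * 2 ^ l))\<^sup>2"]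
        by (simp only: T_Suc) (simp add: zero_le_power2)
    qed
  qed simp
  finally show ?thesis by (simp add: mult.commute)
qed

lemma sum_powr_neg_le:
  fixes s :: real
  assumes "0 < s" "s < 1"
  shows "(\<Sum>k=1..n. real k powr - s) \<le> real n powr (1 - s) / (1 - s)"
proof (induction n)
  case 0
  then show ?case by simp
next
  case (Suc n)
  have "real (Suc n) powr - s \<le> (real (Suc n) powr (1 - s) - real n powr (1 - s)) / (1 - s)"
  proof (cases "n = 0")
    case True
    then show ?thesis using assms by (simp add: field_simps)
  next
    case False
    have "\<exists>z. real n < z \<and> z < real (Suc n) \<and> real (Suc n) powr (1 - s) - real n powr (1 - s)
       = (real (Suc n) - real n) * ((1 - s) * z powr (1 - s - 1))"
    proof (rule MVT2)
      fix x assume "real n \<le> x"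
      with False show "((\<lambda>u. u powr (1 - s)) has_real_derivative (1 - s) * x powr (1 - s - 1)) (at x)"
        by (intro has_real_derivative_powr) simp
    qed simp
    then obtain z where z: "real n < z" "z < real (Suc n)"
      "real (Suc n) powr (1 - s) - real n powr (1 - s) = (1 - s) * z powr - s" by auto
    have "real (Suc n) powr - s \<le> z powr - s"
      using z False assms by (intro powr_mono2') auto
    also have "z powr - s = (real (Suc n) powr (1 - s) - real n powr (1 - s)) / (1 - s)"
      using z(3) assms by simp
    finally show ?thesis .
  qed
  then show ?case using Suc.IH by (simp add: diff_divide_distrib)
qed

lemma sum_decreasing_kernel_le:
  fixes s :: real
  assumes i: "i \<in> {p<..p + L}"
  shows "(\<Sum>j\<in>{p<..p + L}. (real_of_int \<bar>int i - int j\<bar> + 1) powr - s)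
    \<le> 2 * (\<Sum>k=1..L. real k powr - s)"
proof -
  let ?g = "\<lambda>j. (real_of_int \<bar>int i - int j\<bar> + 1) powr - s"
  have left: "sum ?g {p<..i} \<le> (\<Sum>k=1..L. real k powr - s)"
  proof (rule sum_le_included[where i = "\<lambda>k. Suc i - k"])
    show "\<forall>j\<in>{p<..i}. \<exists>k\<in>{1..L}. Suc i - k = j \<and> ?g j \<le> real k powr - s"
    proof
      fix j assume "j \<in> {p<..i}"
      then show "\<exists>k\<in>{1..L}. Suc i - k = j \<and> ?g j \<le> real k powr - s"
        using i by (intro bexI[of _ "Suc i - j"]) (auto simp: of_nat_diff algebra_simps)
    qed
  qed auto
  have right: "sum ?g {i<..p + L} \<le> (\<Sum>k=1..L. real k powr - s)"
  proof (rule sum_le_included[where i = "\<lambda>k. i + k - 1"])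
    show "\<forall>j\<in>{i<..p + L}. \<exists>k\<in>{1..L}. i + k - 1 = j \<and> ?g j \<le> real k powr - s"
    proof
      fix j assume "j \<in> {i<..p + L}"
      then show "\<exists>k\<in>{1..L}. i + k - 1 = j \<and> ?g j \<le> real k powr - s"
        using i by (intro bexI[of _ "Suc j - i"]) (auto simp: of_nat_diff algebra_simps)
    qed
  qed auto
  have "{p<..p + L} = {p<..i} \<union> {i<..p + L}" using i by auto
  then have "sum ?g {p<..p + L} = sum ?g {p<..i} + sum ?g {i<..p + L}"
    by (simp only:) (rule sum.union_disjoint, auto)
  with left right show ?thesis by linarith
qed

text \<open>Covariances that decay like \<open>k powr (- s)\<close> with \<open>0 < s < 1\<close> need not be summable, but each of
  the \<open>L\<close> rows of the covariance matrix of the block has a sum of order \<open>L powr (1 - s)\<close>, which improves the trivial bound \<open>L\<^sup>2\<close>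
  for the second moment.\<close>

lemma (in prob_space) second_moment_block_le:
  fixes Y :: "nat \<Rightarrow> 'a \<Rightarrow> real"
  assumes int: "\<And>i j. i \<ge> 1 \<Longrightarrow> j \<ge> 1 \<Longrightarrow> integrable M (\<lambda>\<omega>. Y i \<omega> * Y j \<omega>)"
    and cov: "\<And>i j. i \<ge> 1 \<Longrightarrow> j \<ge> 1 \<Longrightarrow>
      expectation (\<lambda>\<omega>. Y i \<omega> * Y j \<omega>) \<le> C * (real_of_int \<bar>int i - int j\<bar> + 1) powr - s"
    and "0 \<le> C" and s: "0 < s" "s < 1"
  shows "integrable M (\<lambda>\<omega>. (\<Sum>i\<in>{p<..p + L}. Y i \<omega>)\<^sup>2)" (is ?I)
    and "expectation (\<lambda>\<omega>. (\<Sum>i\<in>{p<..p + L}. Y i \<omega>)\<^sup>2) \<le> 2 * C / (1 - s) * real L powr (2 - s)"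
      (is ?E)
proof -
  let ?B = "{p<..p + L}"
  have eq: "(\<lambda>\<omega>. (\<Sum>i\<in>?B. Y i \<omega>)\<^sup>2) = (\<lambda>\<omega>. \<Sum>i\<in>?B. \<Sum>j\<in>?B. Y i \<omega> * Y j \<omega>)"
    by (simp add: power2_eq_square sum_product)
  show ?I unfolding eq
    by (intro Bochner_Integration.integrable_sum int) auto
  have "expectation (\<lambda>\<omega>. (\<Sum>i\<in>?B. Y i \<omega>)\<^sup>2) = (\<Sum>i\<in>?B. \<Sum>j\<in>?B. expectation (\<lambda>\<omega>. Y i \<omega> * Y j \<omega>))"
    unfolding eq
    by (subst Bochner_Integration.integral_sum, (intro Bochner_Integration.integrable_sum int; force),
        intro sum.cong refl Bochner_Integration.integral_sum int) auto
  also have "\<dots> \<le> (\<Sum>i\<in>?B. \<Sum>j\<in>?B. C * (real_of_int \<bar>int i - int j\<bar> + 1) powr - s)"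
    by (intro sum_mono cov) auto
  also have "\<dots> \<le> (\<Sum>i\<in>?B. C * (2 * (real L powr (1 - s) / (1 - s))))"
  proof (rule sum_mono)
    fix i assume "i \<in> ?B"
    from sum_decreasing_kernel_le[OF this, of s] sum_powr_neg_le[OF s, of L]
    have "(\<Sum>j\<in>?B. (real_of_int \<bar>int i - int j\<bar> + 1) powr - s) \<le> 2 * (real L powr (1 - s) / (1 - s))"
      by linarith
    then show "(\<Sum>j\<in>?B. C * (real_of_int \<bar>int i - int j\<bar> + 1) powr - s)
        \<le> C * (2 * (real L powr (1 - s) / (1 - s)))"
      unfolding sum_distrib_left[symmetric] using \<open>0 \<le> C\<close> by (rule mult_left_mono)
  qed
  also have "\<dots> = 2 * C / (1 - s) * (real L powr 1 * real L powr (1 - s))"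
    by simp
  also have "\<dots> = 2 * C / (1 - s) * real L powr (2 - s)"
    by (simp only: powr_add[symmetric]) simp
  finally show ?E .
qed

text \<open>At each level \<open>l\<close> there are \<open>2 ^ (J - l)\<close> increments of length \<open>2 ^ l\<close>, so the level contributes
  \<open>2 ^ (J - l) * 2 powr (l * (2 - s))\<close>. As \<open>s < 1\<close>, the top level dominates. The price for
  the maximum is thus only the factor \<open>(J + 1)\<^sup>2\<close>: one \<open>J + 1\<close> from Cauchy-Schwarz, one for the
  number of levels.\<close>

lemma (in prob_space) maximal_inequality:
  fixes Y :: "nat \<Rightarrow> 'a \<Rightarrow> real"
  assumes int: "\<And>i j. i \<ge> 1 \<Longrightarrow> j \<ge> 1 \<Longrightarrow> integrable M (\<lambda>\<omega>. Y i \<omega> * Y j \<omega>)"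
    and cov: "\<And>i j. i \<ge> 1 \<Longrightarrow> j \<ge> 1 \<Longrightarrow>
      expectation (\<lambda>\<omega>. Y i \<omega> * Y j \<omega>) \<le> C * (real_of_int \<bar>int i - int j\<bar> + 1) powr - s"
    and C: "0 \<le> C" and s: "0 < s" "s < 1" and t: "0 < t"
  shows "prob {\<omega> \<in> space M. \<exists>m\<le>2 ^ J. t \<le> \<bar>\<Sum>i=1..m. Y i \<omega>\<bar>}
    \<le> 2 * C / (1 - s) * (real J + 1)\<^sup>2 * 2 powr (real J * (2 - s)) / t\<^sup>2"
proof -
  define D where "D l b \<omega> = (\<Sum>i\<in>{b * 2 ^ l<..b * 2 ^ l + 2 ^ l}. Y i \<omega>)\<^sup>2" for l b :: nat and \<omega>
  define Q where "Q \<omega> = (real J + 1) * (\<Sum>l\<le>J. \<Sum>b<2 ^ (J - l). D l b \<omega>)" for \<omega>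
  note block = second_moment_block_le[OF int cov C s]
  have intD: "integrable M (D l b)" for l b
    unfolding D_def by (rule block(1))
  have intQ: "integrable M Q"
    unfolding Q_def by (intro integrable_mult_right Bochner_Integration.integrable_sum intD)
  have ED: "expectation (D l b) \<le> 2 * C / (1 - s) * 2 powr (real l * (2 - s))" for l b
    using block(2)[of "b * 2 ^ l" "2 ^ l"] by (simp add: D_def[abs_def] powr_realpow[symmetric] powr_powr)
  have "expectation Q = (real J + 1) * (\<Sum>l\<le>J. \<Sum>b<2 ^ (J - l). expectation (D l b))"
    unfolding Q_def by (simp add: intD Bochner_Integration.integrable_sum Bochner_Integration.integral_sum)
  also have "\<dots> \<le> (real J + 1) * (\<Sum>l\<le>J. 2 * C / (1 - s) * 2 powr (real J * (2 - s)))"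
  proof (intro mult_left_mono sum_mono)
    fix l assume "l \<in> {..J}"
    then have l: "l \<le> J" by simp
    have "(\<Sum>b<2 ^ (J - l). expectation (D l b))
        \<le> (\<Sum>b<(2::nat) ^ (J - l). 2 * C / (1 - s) * 2 powr (real l * (2 - s)))"
      by (intro sum_mono ED)
    also have "\<dots> = 2 * C / (1 - s) * (2 powr real (J - l) * 2 powr (real l * (2 - s)))"
      by (simp add: powr_realpow)
    also have "\<dots> \<le> 2 * C / (1 - s) * 2 powr (real J * (2 - s))"
    proof (rule mult_left_mono)
      have "real l * (1 - s) \<le> real J * (1 - s)" using l s by (intro mult_right_mono) auto
      then have "real (J - l) + real l * (2 - s) \<le> real J * (2 - s)"
        using l by (simp add: of_nat_diff algebra_simps)
      then show "2 powr real (J - l) * 2 powr (real l * (2 - s)) \<le> 2 powr (real J * (2 - s))"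
        by (simp add: powr_add[symmetric])
    qed (use C s in auto)
    finally show "(\<Sum>b<2 ^ (J - l). expectation (D l b)) \<le> 2 * C / (1 - s) * 2 powr (real J * (2 - s))" .
  qed simp
  also have "\<dots> = 2 * C / (1 - s) * (real J + 1)\<^sup>2 * 2 powr (real J * (2 - s))"
    by (simp add: power2_eq_square)
  finally have EQ: "expectation Q \<le> 2 * C / (1 - s) * (real J + 1)\<^sup>2 * 2 powr (real J * (2 - s))" .
  have max_le_Q: "(\<Sum>i=1..m. Y i \<omega>)\<^sup>2 \<le> Q \<omega>" if "m \<le> 2 ^ J" for m \<omega>
  proof -
    have "D l b \<omega> = ((\<Sum>i=1..Suc b * 2 ^ l. Y i \<omega>) - (\<Sum>i=1..b * 2 ^ l. Y i \<omega>))\<^sup>2" for l b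
    proof -
      have "{1..Suc b * 2 ^ l} = {1..b * 2 ^ l} \<union> {b * 2 ^ l<..b * 2 ^ l + 2 ^ l}" by auto
      then have "(\<Sum>i=1..Suc b * 2 ^ l. Y i \<omega>)
          = (\<Sum>i=1..b * 2 ^ l. Y i \<omega>) + (\<Sum>i\<in>{b * 2 ^ l<..b * 2 ^ l + 2 ^ l}. Y i \<omega>)"
        by (simp only:) (rule sum.union_disjoint, auto)
      then show ?thesis by (simp add: D_def)
    qed
    then show ?thesis
      using square_le_dyadic_increments[of "\<lambda>m. \<Sum>i=1..m. Y i \<omega>", OF _ that]
      by (simp only: Q_def) simp
  qed
  have "{\<omega> \<in> space M. \<exists>m\<le>2 ^ J. t \<le> \<bar>\<Sum>i=1..m. Y i \<omega>\<bar>} \<subseteq> {\<omega> \<in> space M. t\<^sup>2 \<le> Q \<omega>}"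
  proof safe
    fix \<omega> m assume "m \<le> 2 ^ J" and "t \<le> \<bar>\<Sum>i=1..m. Y i \<omega>\<bar>"
    then have "t\<^sup>2 \<le> (\<Sum>i=1..m. Y i \<omega>)\<^sup>2" using t by (metis abs_le_square_iff abs_of_pos)
    also have "\<dots> \<le> Q \<omega>" using \<open>m \<le> 2 ^ J\<close> by (rule max_le_Q)
    finally show "t\<^sup>2 \<le> Q \<omega>" .
  qed
  then have "prob {\<omega> \<in> space M. \<exists>m\<le>2 ^ J. t \<le> \<bar>\<Sum>i=1..m. Y i \<omega>\<bar>} \<le> prob {\<omega> \<in> space M. t\<^sup>2 \<le> Q \<omega>}"
    using intQ by (intro finite_measure_mono) (auto dest: borel_measurable_integrable)
  also have "\<dots> \<le> expectation Q / t\<^sup>2"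
  proof (rule integral_Markov_inequality_measure[OF intQ, of "space M"])
    show "AE \<omega> in M. 0 \<le> Q \<omega>"
      by (auto simp: Q_def D_def intro!: AE_I2 mult_nonneg_nonneg sum_nonneg)
  qed (use t in auto)
  also have "\<dots> \<le> (2 * C / (1 - s) * (real J + 1)\<^sup>2 * 2 powr (real J * (2 - s))) / t\<^sup>2"
    using EQ by (intro divide_right_mono) auto
  finally show ?thesis .
qed

section \<open>Deviations of the empirical distribution function under mixing\<close>

text \<open>The suprema in \<open>alpha_coeff\<close> dominate their members because all values lie in \<open>{0..1}\<close>
  and no index set is empty.\<close>

lemma (in prob_space) abs_cov_le_alpha_coeff:
  assumes k: "1 \<le> k" and A: "A \<in> sigma_rvs M X {1..k}" and B: "B \<in> sigma_rvs M X {k + n..}"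
  shows "\<bar>prob (A \<inter> B) - prob A * prob B\<bar> \<le> alpha_coeff M X n"
proof -
  define g where "g = (\<lambda>(A, B). \<bar>prob (A \<inter> B) - prob A * prob B\<bar>)"
  let ?R = "\<lambda>k. sigma_rvs M X {1..k} \<times> sigma_rvs M X {k + n..}"
  have g_le_1: "g z \<le> 1" for z
  proof -
    obtain A B where z: "z = (A, B)" by (cases z)
    have "0 \<le> prob A * prob B" and "prob A * prob B \<le> 1"
      by (auto intro: mult_le_one)
    moreover have "0 \<le> prob (A \<inter> B)" "prob (A \<inter> B) \<le> 1" by simp_all
    ultimately show ?thesis unfolding g_def z prod.case by linarith
  qed
  have ne: "?R k \<noteq> {}" for k
    by (auto simp: sigma_rvs_def intro: sigma_sets.Empty)
  have "g (A, B) \<le> (SUP z\<in>?R k. g z)"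
    using A B g_le_1 by (intro cSUP_upper) (auto intro!: bdd_aboveI2[where M = 1])
  also have "\<dots> \<le> (SUP k\<in>{1..}. SUP z\<in>?R k. g z)"
    using k g_le_1 ne by (intro cSUP_upper bdd_aboveI2[where M = 1] cSUP_least) auto
  finally show ?thesis
    by (simp add: g_def alpha_coeff_def)
qed

lemma (in prob_space) expectation_mult_centred_indicators:
  assumes "A \<in> events" "B \<in> events"
  shows "expectation (\<lambda>\<omega>. (indicator A \<omega> - prob A) * (indicator B \<omega> - prob B))
    = prob (A \<inter> B) - prob A * prob B"
proof -
  have "(\<lambda>\<omega>. (indicator A \<omega> - prob A) * (indicator B \<omega> - prob B))
      = (\<lambda>\<omega>. indicator (A \<inter> B) \<omega> - prob B * indicator A \<omega> - prob A * indicator B \<omega> + prob A * prob B)"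
    by (simp add: fun_eq_iff indicator_inter_arith algebra_simps)
  moreover have "A \<inter> space M = A" "B \<inter> space M = B" "A \<inter> B \<inter> space M = A \<inter> B"
    using assms[THEN sets.sets_into_space] by auto
  ultimately show ?thesis
    using assms by (simp add: prob_space emeasure_eq_measure)
qed

text \<open>The shift by \<open>1\<close> in the kernel gives it the value \<open>1\<close> on the diagonal, where the covariance
  is at most \<open>1\<close>. Off the diagonal it costs the factor \<open>2 powr s\<close>, since \<open>n + 1 \<le> 2 * n\<close> for \<open>n \<ge> 1\<close>.\<close>

lemma (in prob_space) expectation_centred_indicators_le:
  fixes X :: "nat \<Rightarrow> 'a \<Rightarrow> real"
  assumes meas: "\<And>i. i \<ge> 1 \<Longrightarrow> X i \<in> borel_measurable M"
    and mixing: "\<And>n. n \<ge> 1 \<Longrightarrow> alpha_coeff M X n \<le> K * real n powr - s"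
    and "0 \<le> K" "0 \<le> s" "S \<in> sets borel" "1 \<le> i" "1 \<le> j"
    and A_def: "\<And>i. A i = X i -` S \<inter> space M"
  shows "expectation (\<lambda>\<omega>. (indicator (A i) \<omega> - prob (A i)) * (indicator (A j) \<omega> - prob (A j)))
    \<le> (1 + K * 2 powr s) * (real_of_int \<bar>int i - int j\<bar> + 1) powr - s"
proof -
  have A_events: "A i \<in> events" if "1 \<le> i" for i
    using meas[OF that] \<open>S \<in> sets borel\<close> unfolding A_def by (rule measurable_sets)
  have A_sigma: "A i \<in> sigma_rvs M X I" if "i \<in> I" for i I
    using that \<open>S \<in> sets borel\<close> unfolding A_def sigma_rvs_def by (intro sigma_sets.Basic) blast
  have ordered: "prob (A i \<inter> A j) - prob (A i) * prob (A j)
      \<le> (1 + K * 2 powr s) * (real_of_int \<bar>int i - int j\<bar> + 1) powr - s"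
    if "1 \<le> i" "i < j" for i j
  proof -
    define n where "n = j - i"
    have n: "1 \<le> n" "i + n = j" using that by (auto simp: n_def)
    have "prob (A i \<inter> A j) - prob (A i) * prob (A j) \<le> alpha_coeff M X n"
      using abs_cov_le_alpha_coeff[of i "A i" X "A j" n] that n A_sigma by (auto simp: abs_le_iff)
    also have "\<dots> \<le> K * real n powr - s" by (rule mixing[OF n(1)])
    also have "\<dots> = K * 2 powr s * (2 * real n) powr - s"
      by (simp add: powr_mult powr_minus)
    also have "\<dots> \<le> K * 2 powr s * (real n + 1) powr - s"
      using n \<open>0 \<le> K\<close> \<open>0 \<le> s\<close> by (intro mult_left_mono powr_mono2') auto
    also have "\<dots> \<le> (1 + K * 2 powr s) * (real n + 1) powr - s"
      by (intro mult_right_mono) auto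
    also have "real n = real_of_int \<bar>int i - int j\<bar>" using n by simp
    finally show ?thesis .
  qed
  have "prob (A i \<inter> A j) - prob (A i) * prob (A j)
      \<le> (1 + K * 2 powr s) * (real_of_int \<bar>int i - int j\<bar> + 1) powr - s"
  proof (cases i j rule: linorder_cases)
    case less
    with \<open>1 \<le> i\<close> show ?thesis by (rule ordered)
  next
    case equal
    have "prob (A i \<inter> A j) - prob (A i) * prob (A j) \<le> 1 - 0"
      by (intro diff_mono) auto
    with equal \<open>0 \<le> K\<close> show ?thesis by (simp add: add_increasing2)
  next
    case greater
    then show ?thesis using ordered[of j i] \<open>1 \<le> j\<close> by (simp add: Int_commute mult.commute[of "prob (A j)"] abs_minus_commute)
  qed
  then show ?thesis
    using A_events \<open>1 \<le> i\<close> \<open>1 \<le> j\<close> by (simp add: expectation_mult_centred_indicators)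
qed

lemma summable_square_times_geometric:
  fixes d :: real
  assumes "0 < d"
  shows "summable (\<lambda>J::nat. (real J + 1)\<^sup>2 * 2 powr (- d * real J))"
proof (rule summable_comparison_test_bigo)
  have "summable (\<lambda>J. (2 powr (- d / 2)) ^ J)"
    using assms by (intro summable_geometric) (simp add: powr_less_one)
  then show "summable (\<lambda>J. norm (2 powr (- d / 2 * real J)))"
    by (simp add: powr_powr powr_realpow[symmetric])
  show "(\<lambda>J::nat. (real J + 1)\<^sup>2 * 2 powr (- d * real J)) \<in> O(\<lambda>J. 2 powr (- d / 2 * real J))"
    using assms by real_asymp
qed

text \<open>The threshold \<open>x J\<close> may vary arbitrarily with \<open>J\<close>, because the Borel-Cantelli lemma uses only
  the probabilities of the individual events, and the bound from the maximal inequality does not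
  depend on the threshold. The condition on \<open>n\<close> and \<open>J\<close> places \<open>n\<close> in the dyadic block between
  \<open>2 ^ (J - 1)\<close> and \<open>2 ^ J\<close>.\<close>

lemma (in prob_space) emp_cdf_deviation_at_moving_thresholds:
  fixes X :: "nat \<Rightarrow> 'a \<Rightarrow> real" and x :: "nat \<Rightarrow> real"
  assumes meas: "\<And>i. i \<ge> 1 \<Longrightarrow> X i \<in> borel_measurable M"
    and ident: "\<And>i. i \<ge> 1 \<Longrightarrow> distr M borel (X i) = distr M borel (X 1)"
    and F: "F = cdf (distr M borel (X 1))"
    and mixing: "\<And>n. n \<ge> 1 \<Longrightarrow> alpha_coeff M X n \<le> K * real n powr - s"
    and "0 \<le> K" "0 \<le> r" "2 * r < s" "s < 1" "0 < c"
  shows "AE \<omega> in M. \<forall>\<^sub>F J in sequentially. \<forall>n. n \<le> 2 ^ J \<and> 2 ^ J \<le> 2 * n \<longrightarrow>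
    \<bar>emp_cdf X n \<omega> (x J) - F (x J)\<bar> < c * 2 powr (- r * real J)"
proof -
  have s: "0 < s" "0 \<le> s" using \<open>0 \<le> r\<close> \<open>2 * r < s\<close> by auto
  define A where "A z i = X i -` {..z} \<inter> space M" for z i
  have A_events: "A z i \<in> events" if "1 \<le> i" for z i
    using meas[OF that] by (auto simp: A_def)
  have prob_A: "prob (A z i) = F z" if "1 \<le> i" for z i
  proof -
    have "F z = measure (distr M borel (X i)) {..z}"
      by (simp only: F ident[OF that] cdf_def)
    then show ?thesis using meas[OF that] by (simp add: measure_distr A_def)
  qed
  define C where "C = 1 + K * 2 powr s"
  have "0 \<le> C" using \<open>0 \<le> K\<close> by (simp add: C_def)
  define Y where "Y z i \<omega> = indicator (A z i) \<omega> - F z" for z i and \<omega> :: 'a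
  have Y_meas: "Y z i \<in> borel_measurable M" if "1 \<le> i" for z i
    using A_events[OF that] unfolding Y_def by measurable
  have Y_int: "integrable M (\<lambda>\<omega>. Y z i \<omega> * Y z j \<omega>)" if "1 \<le> i" "1 \<le> j" for z i j
  proof (rule integrable_const_bound[of _ "(1 + \<bar>F z\<bar>) * (1 + \<bar>F z\<bar>)"])
    have "\<bar>Y z i \<omega>\<bar> \<le> 1 + \<bar>F z\<bar>" for i \<omega>
      by (auto simp: Y_def indicator_def)
    then show "AE \<omega> in M. norm (Y z i \<omega> * Y z j \<omega>) \<le> (1 + \<bar>F z\<bar>) * (1 + \<bar>F z\<bar>)"
      by (auto simp: abs_mult intro!: mult_mono)
    show "(\<lambda>\<omega>. Y z i \<omega> * Y z j \<omega>) \<in> borel_measurable M"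
      using Y_meas that by (intro borel_measurable_times)
  qed
  have Y_cov: "expectation (\<lambda>\<omega>. Y z i \<omega> * Y z j \<omega>) \<le> C * (real_of_int \<bar>int i - int j\<bar> + 1) powr - s"
    if "1 \<le> i" "1 \<le> j" for z i j
    using expectation_centred_indicators_le[OF meas mixing \<open>0 \<le> K\<close> s(2) _ that, of "{..z}" "A z"] that
    by (simp add: Y_def prob_A C_def A_def[symmetric])
  have emp: "\<bar>emp_cdf X n \<omega> z - F z\<bar> = \<bar>\<Sum>i=1..n. Y z i \<omega>\<bar> / real n" if "0 < n" "\<omega> \<in> space M" for n z \<omega>
  proof -
    have "(\<Sum>i=1..n. Y z i \<omega>) = (\<Sum>i=1..n. indicator {X i \<omega>..} z) - real n * F z"
      using that by (simp add: Y_def sum_subtractf A_def indicator_def)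
    then have "emp_cdf X n \<omega> z - F z = (\<Sum>i=1..n. Y z i \<omega>) / real n"
      using that by (simp add: emp_cdf_def field_simps)
    then show ?thesis by simp
  qed
  \<comment> \<open>Dividing the partial sum by \<open>n \<ge> 2 ^ J / 2\<close> must leave at most \<open>c * 2 powr (- r * J)\<close>.\<close>
  define t where "t J = c / 2 * 2 powr ((1 - r) * real J)" for J :: nat
  have t_pos: "0 < t J" for J using \<open>0 < c\<close> by (simp add: t_def)
  define E where "E J = {\<omega> \<in> space M. \<exists>m\<le>2 ^ J. t J \<le> \<bar>\<Sum>i=1..m. Y (x J) i \<omega>\<bar>}" for J
  have E_meas: "E J \<in> events" for J
  proof -
    have "(\<lambda>\<omega>. \<Sum>i=1..m. Y (x J) i \<omega>) \<in> borel_measurable M" for m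
      using Y_meas by (intro borel_measurable_sum) auto
    note [measurable] = this
    show ?thesis unfolding E_def by measurable
  qed
  define B where "B = 8 * C / (1 - s) / c\<^sup>2"
  have E_le: "prob (E J) \<le> B * ((real J + 1)\<^sup>2 * 2 powr (- (s - 2 * r) * real J))" for J
  proof -
    have "prob (E J) \<le> 2 * C / (1 - s) * (real J + 1)\<^sup>2 * 2 powr (real J * (2 - s)) / (t J)\<^sup>2"
      unfolding E_def using Y_int Y_cov \<open>0 \<le> C\<close> s(1) \<open>s < 1\<close> t_pos by (rule maximal_inequality)
    also have "(t J)\<^sup>2 = c\<^sup>2 / 4 * 2 powr (2 * ((1 - r) * real J))"
      by (simp add: t_def power_mult_distrib power_divide powr_power mult.commute)
    also have "2 * C / (1 - s) * (real J + 1)\<^sup>2 * 2 powr (real J * (2 - s)) / (c\<^sup>2 / 4 * 2 powr (2 * ((1 - r) * real J)))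
        = B * ((real J + 1)\<^sup>2 * (2 powr (real J * (2 - s)) / 2 powr (2 * ((1 - r) * real J))))"
      by (simp add: B_def)
    also have "2 powr (real J * (2 - s)) / 2 powr (2 * ((1 - r) * real J)) = 2 powr (- (s - 2 * r) * real J)"
      by (simp add: powr_diff[symmetric] algebra_simps)
    finally show ?thesis .
  qed
  have "summable (\<lambda>J. B * ((real J + 1)\<^sup>2 * 2 powr (- (s - 2 * r) * real J)))"
    using \<open>2 * r < s\<close> by (intro summable_mult summable_square_times_geometric) simp
  then have "summable (\<lambda>J. prob (E J))"
    by (rule summable_comparison_test'[where N = 0]) (simp only: real_norm_def abs_of_nonneg[OF measure_nonneg] E_le)
  then have "AE \<omega> in M. \<forall>\<^sub>F J in sequentially. \<omega> \<in> space M - E J"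
    using E_meas by (intro borel_cantelli_AE1) (auto simp: emeasure_eq_measure)
  then show ?thesis
  proof (eventually_elim, elim eventually_mono, intro allI impI)
    fix \<omega> and J n :: nat
    assume \<omega>: "\<omega> \<in> space M - E J" and n: "n \<le> 2 ^ J \<and> 2 ^ J \<le> 2 * n"
    have pow: "(2::real) ^ J = 2 powr real J" by (simp add: powr_realpow)
    have "(2::real) ^ J \<le> 2 * real n"
      using n by (metis of_nat_le_iff of_nat_mult of_nat_numeral of_nat_power)
    moreover have "0 < n" using n by (cases n) auto
    moreover have "t J = c * 2 powr (- r * real J) * (2 ^ J / 2)"
      by (simp add: t_def pow powr_add[symmetric] algebra_simps)
    ultimately have "t J \<le> c * 2 powr (- r * real J) * real n"
      using \<open>0 < c\<close> by (simp only:) (intro mult_left_mono; simp)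
    moreover have "\<bar>\<Sum>i=1..n. Y (x J) i \<omega>\<bar> < t J"
      using \<omega> n by (force simp: E_def not_le[symmetric])
    ultimately show "\<bar>emp_cdf X n \<omega> (x J) - F (x J)\<bar> < c * 2 powr (- r * real J)"
      using emp[of n \<omega> "x J"] \<open>0 < n\<close> \<omega> by (simp add: pos_divide_less_eq)
  qed
qed

section \<open>Left-continuous inverses\<close>

lemma left_inv_le: "y \<le> H x \<Longrightarrow> left_inv H y \<le> ereal x"
  unfolding left_inv_def by (intro Inf_lower) auto

lemma le_left_inv:
  assumes "mono H" "H x < y"
  shows "ereal x \<le> left_inv H y"
  unfolding left_inv_def
proof (rule Inf_greatest)
  fix u assume "u \<in> ereal ` {z. y \<le> H z}"
  then obtain z where "u = ereal z" "y \<le> H z" by auto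
  moreover from this assms have "x \<le> z" by (meson le_cases monoD order.trans not_less)
  ultimately show "ereal x \<le> u" by simp
qed

lemma mono_emp_cdf: "mono (emp_cdf X n \<omega>)"
  unfolding emp_cdf_def by (intro monoI mult_left_mono sum_mono) (auto simp: indicator_def)

text \<open>The infimum defining the quantile is finite because \<open>0 < y < 1\<close> and \<open>cdf M\<close> tends to \<open>0\<close> and
  \<open>1\<close> at the two ends of the line. It is attained because \<open>cdf M\<close> is continuous from the right.\<close>

lemma (in real_distribution) left_inv_cdf:
  assumes "0 < y" "y < 1"
  obtains q where "left_inv (cdf M) y = ereal q" "y \<le> cdf M q" "\<And>z. z < q \<Longrightarrow> cdf M z < y"
proof -
  let ?S = "{z. y \<le> cdf M z}"
  define q where "q = Inf ?S"
  have "\<forall>\<^sub>F z in at_top. y < cdf M z"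
    using cdf_lim_at_top_prob \<open>y < 1\<close> by (rule order_tendstoD)
  then obtain b where "y < cdf M b" by (auto dest: eventually_happens)
  then have ne: "?S \<noteq> {}" by (auto intro: less_imp_le)
  have "\<forall>\<^sub>F z in at_bot. cdf M z < y"
    using cdf_lim_at_bot \<open>0 < y\<close> by (rule order_tendstoD)
  then obtain a where "cdf M a < y" by (auto dest: eventually_happens)
  have bdd: "bdd_below ?S"
  proof (rule bdd_belowI)
    fix z assume "z \<in> ?S"
    with \<open>cdf M a < y\<close> have "\<not> z \<le> a" using cdf_nondecreasing[of z a] by auto
    then show "a \<le> z" by simp
  qed
  have below: "cdf M z < y" if "z < q" for z
  proof (rule ccontr)
    assume "\<not> cdf M z < y"
    then have "q \<le> z" unfolding q_def by (intro cInf_lower bdd) simp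
    with that show False by simp
  qed
  have above: "y \<le> cdf M z" if "q < z" for z
  proof -
    obtain w where "y \<le> cdf M w" "w < z"
      using cInf_lessD[OF ne, of z] \<open>q < z\<close> by (auto simp: q_def)
    with cdf_nondecreasing[of w z] show ?thesis by simp
  qed
  have "y \<le> cdf M q"
  proof (rule tendsto_lowerbound)
    show "(cdf M \<longlongrightarrow> cdf M q) (at_right q)"
      using cdf_is_right_cont by (simp add: continuous_within)
    show "\<forall>\<^sub>F z in at_right q. y \<le> cdf M z"
      using above by (auto intro: eventually_at_rightI[of q "q + 1"])
  qed simp
  moreover from this have "left_inv (cdf M) y = ereal q"
    unfolding left_inv_def by (intro cInf_eq_minimum) (use below in \<open>force simp: not_less[symmetric]\<close>)+
  ultimately show thesis using below by (intro that)
qed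

lemma DERIV_pos_imp_linear_growth:
  fixes F :: "real \<Rightarrow> real"
  assumes F: "(F has_real_derivative d) (at q)" and "c < d"
  obtains \<delta> where "0 < \<delta>"
    "\<And>h. 0 < h \<Longrightarrow> h < \<delta> \<Longrightarrow> F q + c * h \<le> F (q + h) \<and> F (q - h) \<le> F q - c * h"
proof -
  have "((\<lambda>h. (F (q + h) - F q) / h) \<longlongrightarrow> d) (at 0)"
    using F by (simp add: DERIV_def)
  then have "\<forall>\<^sub>F h in at 0. c < (F (q + h) - F q) / h"
    using \<open>c < d\<close> by (rule order_tendstoD)
  then obtain \<delta> where "0 < \<delta>" and \<delta>: "\<And>h. h \<noteq> 0 \<Longrightarrow> \<bar>h\<bar> < \<delta> \<Longrightarrow> c < (F (q + h) - F q) / h"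
    by (auto simp: eventually_at dist_real_def)
  show thesis
  proof (rule that[OF \<open>0 < \<delta>\<close>])
    fix h assume "0 < h" "h < \<delta>"
    with \<delta>[of h] \<delta>[of "- h"] show "F q + c * h \<le> F (q + h) \<and> F (q - h) \<le> F q - c * h"
      by (simp add: field_simps)
  qed
qed

section \<open>Almost sure rate of convergence of empirical quantiles\<close>

text \<open>The extended-real quantiles enter only through real brackets around \<open>q\<close>, so that for the
  relevant \<open>n\<close> all values are finite.\<close>

lemma ereal_rate_tendsto_0I:
  fixes a :: "nat \<Rightarrow> ereal" and q :: real
  assumes \<epsilon>: "\<epsilon> \<longlonglongrightarrow> (0::real)"
    and bound: "\<And>k. \<forall>\<^sub>F n in sequentially. \<exists>h. real n powr r * h \<le> \<epsilon> k \<and>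
      ereal (q - h) \<le> a n \<and> a n \<le> ereal (q + h)"
  shows "(\<lambda>n. ereal (real n powr r) * \<bar>a n - ereal q\<bar>) \<longlonglongrightarrow> 0"
proof (rule order_tendstoI)
  fix b :: ereal assume "b < 0"
  then show "\<forall>\<^sub>F n in sequentially. b < ereal (real n powr r) * \<bar>a n - ereal q\<bar>"
    by (intro always_eventually allI) (auto intro!: less_le_trans[of b 0] ereal_0_le_mult)
next
  fix b :: ereal assume "0 < b"
  then obtain b' where b': "0 < ereal b'" "ereal b' < b"
    using ereal_dense2 by blast
  then have "\<forall>\<^sub>F k in sequentially. \<epsilon> k < b'"
    using \<epsilon> by (intro order_tendstoD) auto
  then obtain k where k: "\<epsilon> k < b'" by (auto dest: eventually_happens)
  from bound[of k] show "\<forall>\<^sub>F n in sequentially. ereal (real n powr r) * \<bar>a n - ereal q\<bar> < b"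
  proof (rule eventually_mono)
    fix n assume "\<exists>h. real n powr r * h \<le> \<epsilon> k \<and> ereal (q - h) \<le> a n \<and> a n \<le> ereal (q + h)"
    then obtain h where h: "real n powr r * h \<le> \<epsilon> k" "ereal (q - h) \<le> a n" "a n \<le> ereal (q + h)"
      by auto
    then obtain a' where a': "a n = ereal a'" by (cases "a n") auto
    with h have "\<bar>a' - q\<bar> \<le> h" by auto
    then have "real n powr r * \<bar>a' - q\<bar> \<le> real n powr r * h" by (intro mult_left_mono) auto
    with h(1) k have "ereal (real n powr r * \<bar>a' - q\<bar>) < ereal b'" by simp
    also note b'(2)
    finally show "ereal (real n powr r) * \<bar>a n - ereal q\<bar> < b" by (simp add: a')
  qed
qed

theorem theorem3p6:
  fixes M :: "'a measure" and X :: "nat \<Rightarrow> 'a \<Rightarrow> real" and F :: "real \<Rightarrow> real"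
    and r K \<theta> y :: real
  assumes "prob_space M"
    and "\<And>i. i \<ge> 1 \<Longrightarrow> X i \<in> borel_measurable M"
    and "\<And>i. i \<ge> 1 \<Longrightarrow> distr M borel (X i) = distr M borel (X 1)"
    and "F = cdf (distr M borel (X 1))"
    and "alpha_mixing M X"
    and "0 \<le> r" and "r < 1 / 2"
    and "K > 0" and "\<theta> > 2 * r"
    and "\<And>n. n \<ge> 1 \<Longrightarrow> alpha_coeff M X n \<le> K * real n powr (- \<theta>)"
    and "0 < y" and "y < 1"
    and "F differentiable (at (real_of_ereal (left_inv F y)))"
    and "deriv F (real_of_ereal (left_inv F y)) > 0"
  shows "AE \<omega> in M.
    (\<lambda>n. ereal (real n powr r) * \<bar>left_inv (emp_cdf X n \<omega>) y - left_inv F y\<bar>) \<longlonglongrightarrow> 0"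
proof -
  note meas = assms(2) and ident = assms(3) and F = assms(4)
  interpret prob_space M by fact
  interpret D: real_distribution "distr M borel (X 1)"
    using meas by (intro real_distribution_distr) simp
  obtain q where q: "left_inv F y = ereal q" "y \<le> F q" and below_q: "\<And>z. z < q \<Longrightarrow> F z < y"
    using D.left_inv_cdf[OF \<open>0 < y\<close> \<open>y < 1\<close>] unfolding F by blast
  define d where "d = deriv F q"
  have "0 < d" and F': "(F has_real_derivative d) (at q)"
    using assms(13,14) by (simp_all add: q d_def DERIV_deriv_iff_real_differentiable)
  have "F q \<le> y"
  proof (rule tendsto_upperbound)
    show "(F \<longlongrightarrow> F q) (at_left q)"
      using DERIV_isCont[OF F'] by (auto simp: isCont_def intro: tendsto_within_subset)
    show "\<forall>\<^sub>F z in at_left q. F z \<le> y"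
      using below_q by (auto intro!: eventually_at_leftI[of "q - 1" q] less_imp_le)
  qed simp
  with q have F_q: "F q = y" by simp
  define c where "c = d / 2"
  have c: "0 < c" "c < d" using \<open>0 < d\<close> by (simp_all add: c_def)
  obtain \<delta> where "0 < \<delta>"
    and growth: "\<And>h. 0 < h \<Longrightarrow> h < \<delta> \<Longrightarrow> y + c * h \<le> F (q + h) \<and> F (q - h) \<le> y - c * h"
    using DERIV_pos_imp_linear_growth[OF F' c(2)] unfolding F_q by blast
  \<comment> \<open>Lowering the exponent \<open>\<theta>\<close> to some \<open>s < 1\<close> keeps a positive gap to \<open>2 * r\<close>, since \<open>r < 1 / 2\<close>.\<close>
  obtain s where s: "2 * r < s" "s < 1" "s \<le> \<theta>"
    using dense[of "2 * r" "min 1 \<theta>"] \<open>r < 1 / 2\<close> \<open>2 * r < \<theta>\<close> by (auto intro: less_imp_le)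
  have mixing: "alpha_coeff M X n \<le> K * real n powr - s" if "1 \<le> n" for n
  proof -
    have "K * real n powr - \<theta> \<le> K * real n powr - s"
      using that s \<open>0 < K\<close> by (intro mult_left_mono powr_mono) auto
    with assms(10)[OF that] show ?thesis by simp
  qed
  \<comment> \<open>A sequence suffices in place of all small \<open>\<epsilon>\<close>, which keeps the exceptional set null. All
    widths stay below \<open>\<delta>\<close>, even for \<open>r = 0\<close>, where they do not shrink with \<open>J\<close>.\<close>
  define \<epsilon> where "\<epsilon> k = \<delta> / real (k + 2)" for k
  define h where "h k J = \<epsilon> k * 2 powr (- r * real J)" for k J
  have \<epsilon>: "0 < \<epsilon> k" "\<epsilon> k < \<delta>" for k
    using \<open>0 < \<delta>\<close> by (simp_all add: \<epsilon>_def field_simps add_pos_nonneg)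
  have "\<epsilon> \<longlonglongrightarrow> 0"
    unfolding \<epsilon>_def[abs_def] by real_asymp
  have h: "0 < h k J" "h k J < \<delta>" for k J
  proof -
    have "2 powr (- r * real J) \<le> 2 powr 0" using \<open>0 \<le> r\<close> by (intro powr_mono) auto
    then have "h k J \<le> \<epsilon> k * 1" unfolding h_def using \<epsilon>[of k] by (intro mult_left_mono) auto
    with \<epsilon>[of k] show "h k J < \<delta>" by linarith
    show "0 < h k J" using \<epsilon>[of k] by (simp add: h_def)
  qed
  define close where "close x k \<omega> \<longleftrightarrow> (\<forall>\<^sub>F J in sequentially. \<forall>n. n \<le> 2 ^ J \<and> 2 ^ J \<le> 2 * n \<longrightarrow>
      \<bar>emp_cdf X n \<omega> (x J) - F (x J)\<bar> < c * h k J)" for x :: "nat \<Rightarrow> real" and k \<omega>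
  have "AE \<omega> in M. close x k \<omega>" for x k
    using emp_cdf_deviation_at_moving_thresholds[OF meas ident F mixing _ \<open>0 \<le> r\<close> s(1,2), of "c * \<epsilon> k" x]
      \<open>0 < K\<close> c \<epsilon>[of k] by (simp add: close_def h_def mult.assoc)
  then have "AE \<omega> in M. \<forall>k. close (\<lambda>J. q + h k J) k \<omega> \<and> close (\<lambda>J. q - h k J) k \<omega>"
    unfolding AE_all_countable by simp
  then show ?thesis
  proof (rule AE_mp, intro AE_I2 impI)
    fix \<omega> assume close: "\<forall>k. close (\<lambda>J. q + h k J) k \<omega> \<and> close (\<lambda>J. q - h k J) k \<omega>"
    show "(\<lambda>n. ereal (real n powr r) * \<bar>left_inv (emp_cdf X n \<omega>) y - left_inv F y\<bar>) \<longlonglongrightarrow> 0"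
      unfolding q(1)
    proof (rule ereal_rate_tendsto_0I[OF \<open>\<epsilon> \<longlonglongrightarrow> 0\<close>])
      fix k
      have "\<forall>\<^sub>F J in sequentially. \<forall>n. n \<le> 2 ^ J \<and> 2 ^ J \<le> 2 * n \<longrightarrow>
          \<bar>emp_cdf X n \<omega> (q + h k J) - F (q + h k J)\<bar> < c * h k J \<and>
          \<bar>emp_cdf X n \<omega> (q - h k J) - F (q - h k J)\<bar> < c * h k J"
        using close[rule_format, of k] unfolding close_def eventually_conj_iff[symmetric]
        by (rule eventually_mono) blast
      then obtain J0 where J0: "\<And>J n. J0 \<le> J \<Longrightarrow> n \<le> 2 ^ J \<Longrightarrow> 2 ^ J \<le> 2 * n \<Longrightarrow>
          \<bar>emp_cdf X n \<omega> (q + h k J) - F (q + h k J)\<bar> < c * h k J \<and>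
          \<bar>emp_cdf X n \<omega> (q - h k J) - F (q - h k J)\<bar> < c * h k J"
        unfolding eventually_sequentially by blast
      show "\<forall>\<^sub>F n in sequentially. \<exists>h. real n powr r * h \<le> \<epsilon> k \<and>
          ereal (q - h) \<le> left_inv (emp_cdf X n \<omega>) y \<and> left_inv (emp_cdf X n \<omega>) y \<le> ereal (q + h)"
        unfolding eventually_sequentially
      proof (rule exI, intro allI impI)
        fix n :: nat assume n: "2 ^ J0 \<le> n"
        then have "1 \<le> n" by (metis one_le_numeral one_le_power order.trans)
        obtain j where j: "2 ^ j \<le> n" "n < 2 ^ Suc j"
          using ex_power_ivl1[of 2 n] \<open>1 \<le> n\<close> by auto
        define J where "J = Suc j"
        have J: "n \<le> 2 ^ J" "2 ^ J \<le> 2 * n" using j by (simp_all add: J_def)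
        have "(2::nat) ^ J0 < 2 ^ J" using n j(2) unfolding J_def by (rule le_less_trans)
        then have "J0 \<le> J" by simp
        note dev = J0[OF this J] and gr = growth[OF h[of k J]]
        have "real n \<le> 2 ^ J" using J(1) by (metis of_nat_le_iff of_nat_numeral of_nat_power)
        then have "real n powr r \<le> (2 ^ J) powr r" using \<open>0 \<le> r\<close> by (intro powr_mono2) auto
        also have "\<dots> = 2 powr (r * real J)" by (simp add: powr_realpow[symmetric] powr_powr mult.commute)
        finally have "real n powr r * h k J \<le> 2 powr (r * real J) * h k J"
          using h[of k J] by (intro mult_right_mono) auto
        also have "\<dots> = \<epsilon> k" by (simp add: h_def powr_minus)
        finally have rate: "real n powr r * h k J \<le> \<epsilon> k" .
        have lower: "ereal (q - h k J) \<le> left_inv (emp_cdf X n \<omega>) y"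
          using dev gr by (intro le_left_inv mono_emp_cdf) linarith
        have upper: "left_inv (emp_cdf X n \<omega>) y \<le> ereal (q + h k J)"
          using dev gr by (intro left_inv_le) linarith
        from rate lower upper show "\<exists>h. real n powr r * h \<le> \<epsilon> k \<and>
            ereal (q - h) \<le> left_inv (emp_cdf X n \<omega>) y \<and> left_inv (emp_cdf X n \<omega>) y \<le> ereal (q + h)"
          by blast
      qed
    qed
  qed
qed

end
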